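(* Let $n\ge 2$ be an integer and let $0<\epsilon<2\pi/n$. On $\mathbb{R}^n$ define $\rho_j(\mathbf{x})=x_{j+1}-x_j-\epsilon$ for $j=1,\dots,n-1$, and $\rho_n(\mathbf{x})=x_1+2\pi-x_n-\epsilon$, and let $\widetilde{\mathbb{R}}^n_\epsilon=\{\mathbf{x}\in\mathbb{R}^n:\rho_j(\mathbf{x})>0,\ j=1,\dots,n\}$. Then there exist smooth vector fields $\vec f_1,\dots,\vec f_m$ on $\mathbb{R}^n$, $m\le n$, which are periodic with period $2\pi$ in each variable, such that: (i) the hypersurfaces $\{\rho_j=0\}$, $j=1,\dots,n-1$, the hypersurface $\{\rho_n=0\}$, and the open submanifold $\widetilde{\mathbb{R}}^n_\epsilon$ are invariant under the flow of each of the vector fields $\pm\vec f_\ell$, $\ell=1,\dots,m$; (ii) the vector fields $\vec f_\ell$ and $[\vec f_\ell,\vec f_k]$, $\ell,k=1,\dots,m$, span the whole tangent space at every point of $\widetilde{\mathbb{R}}^n_\epsilon$. Such vector fields $\vec f_1,\dots,\vec f_m$ (satisfying (i) and (ii)) are constructible for every integer $m\le n$ in the following cases: Case 1: both $n$ and $m$ are odd and $2m\ge n+1$. Case 2: $n$ is even and $2m\ge n+2$.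
   Context: Smooth means $C^\infty$; points of $\mathbb{R}^n$ are written $\mathbf{x}=(x_1,\dots,x_n)$. A vector field $\sum_{j=1}^n a_j(\mathbf{x})\,\partial/\partial x_j$ on $\mathbb{R}^n$ is periodic with period $2\pi$ if each coefficient $a_j$ is $2\pi$-periodic in each of the variables $x_1,\dots,x_n$. A set $N$ is invariant under the flow of a vector field if every integral curve starting at a point of $N$ stays in $N$ for all times $t\ge 0$ at which it is defined. $[\cdot,\cdot]$ is the Lie bracket of vector fields. *)

theory Defs
  imports "HOL-Analysis.Analysis"
begin

text \<open>
  Coordinates: the index type \<open>'n\<close> of \<open>real ^ 'n\<close> carries no order, so an enumeration
  \<open>e\<close> with \<open>bij_betw e {1..n} UNIV\<close> plays the role of the numbering
  \<open>x\<^sub>1, \<dots>, x\<^sub>n\<close>: the coordinate \<open>x\<^sub>j\<close> is \<open>x $ e j\<close>.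
  A vector field \<open>\<Sum>j. a\<^sub>j \<partial>/\<partial>x\<^sub>j\<close> is the map with component functions
  \<open>a\<^sub>j\<close>.
\<close>

type_synonym 'n vfield = "real ^ 'n \<Rightarrow> real ^ 'n"

text \<open>
  The derivative in the recursion is the full Frechet derivative, in every direction \<open>v\<close>.
  On a finite-dimensional domain, \<open>C_k k f\<close> holds for all \<open>k\<close> iff all iterated
  partial derivatives of \<open>f\<close> exist and are continuous.
\<close>

fun C_k :: "nat \<Rightarrow> ('a::real_normed_vector \<Rightarrow> 'b::real_normed_vector) \<Rightarrow> bool" where
  "C_k 0 f \<longleftrightarrow> continuous_on UNIV f"
| "C_k (Suc k) f \<longleftrightarrow>
     (\<forall>x. f differentiable (at x)) \<and> (\<forall>v. C_k k (\<lambda>x. frechet_derivative f (at x) v))"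

definition smooth :: "('a::real_normed_vector \<Rightarrow> 'b::real_normed_vector) \<Rightarrow> bool" where
  "smooth f \<longleftrightarrow> (\<forall>k. C_k k f)"

definition periodic_2pi :: "'n::finite vfield \<Rightarrow> bool" where
  "periodic_2pi X \<longleftrightarrow> (\<forall>x i. X (x + (2 * pi) *\<^sub>R axis i 1) = X x)"

text \<open>
  In coordinates: \<open>[X, Y]\<^sub>j = \<Sum>i. X\<^sub>i \<partial>Y\<^sub>j/\<partial>x\<^sub>i - Y\<^sub>i \<partial>X\<^sub>j/\<partial>x\<^sub>i\<close>.
\<close>

definition lie_bracket :: "'n::finite vfield \<Rightarrow> 'n vfield \<Rightarrow> 'n vfield" where
  "lie_bracket X Y = (\<lambda>x. frechet_derivative Y (at x) (X x) - frechet_derivative X (at x) (Y x))"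

definition integral_curve :: "'n::finite vfield \<Rightarrow> real set \<Rightarrow> (real \<Rightarrow> real ^ 'n) \<Rightarrow> bool" where
  "integral_curve X I \<gamma> \<longleftrightarrow>
     is_interval I \<and> (\<forall>t\<in>I. (\<gamma> has_vector_derivative X (\<gamma> t)) (at t within I))"

definition flow_invariant :: "'n::finite vfield \<Rightarrow> (real ^ 'n) set \<Rightarrow> bool" where
  "flow_invariant X N \<longleftrightarrow>
     (\<forall>I \<gamma>. integral_curve X I \<gamma> \<longrightarrow> 0 \<in> I \<longrightarrow> \<gamma> 0 \<in> N \<longrightarrow> (\<forall>t\<in>I. 0 \<le> t \<longrightarrow> \<gamma> t \<in> N))"

definition rho :: "(nat \<Rightarrow> 'n::finite) \<Rightarrow> nat \<Rightarrow> real \<Rightarrow> nat \<Rightarrow> real ^ 'n \<Rightarrow> real" where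
  "rho e n \<epsilon> j x =
     (if j = n then x $ e 1 + 2 * pi - x $ e n - \<epsilon>
      else x $ e (j + 1) - x $ e j - \<epsilon>)"

definition R_eps :: "(nat \<Rightarrow> 'n::finite) \<Rightarrow> nat \<Rightarrow> real \<Rightarrow> (real ^ 'n) set" where
  "R_eps e n \<epsilon> = {x. \<forall>j\<in>{1..n}. rho e n \<epsilon> j x > 0}"

text \<open>
  \<open>f 1, \<dots>, f m\<close> are smooth periodic vector fields satisfying conditions (i) (the next three
  conjuncts) and (ii) (the last one).
\<close>

definition good_fields ::
  "(nat \<Rightarrow> 'n::finite) \<Rightarrow> nat \<Rightarrow> real \<Rightarrow> nat \<Rightarrow> (nat \<Rightarrow> 'n vfield) \<Rightarrow> bool" where
  "good_fields e n \<epsilon> m f \<longleftrightarrow>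
     (\<forall>l\<in>{1..m}. smooth (f l) \<and> periodic_2pi (f l)) \<and>
     (\<forall>l\<in>{1..m}. \<forall>j\<in>{1..n}.
        flow_invariant (f l) {x. rho e n \<epsilon> j x = 0} \<and>
        flow_invariant (\<lambda>x. - f l x) {x. rho e n \<epsilon> j x = 0}) \<and>
     (\<forall>l\<in>{1..m}. flow_invariant (f l) (R_eps e n \<epsilon>)) \<and>
     (\<forall>l\<in>{1..m}. flow_invariant (\<lambda>x. - f l x) (R_eps e n \<epsilon>)) \<and>
     (\<forall>x\<in>R_eps e n \<epsilon>.
        span ({f l x | l. l \<in> {1..m}} \<union>
              {lie_bracket (f l) (f k) x | l k. l \<in> {1..m} \<and> k \<in> {1..m}}) = UNIV)"

end

theory Submission
  imports Defs
begin

text \<open>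
  Let \<open>\<phi> = \<Prod>j. (1 - cos \<rho>\<^sub>j)\<close>. It is smooth, periodic, vanishes on every hypersurface
  \<open>\<rho>\<^sub>j = 0\<close>, and is positive on the open set, because there the \<open>\<rho>\<^sub>j\<close> are positive with sum
  less than \<open>2\<pi>\<close>. Multiplying arbitrary smooth periodic fields \<open>Y\<^sub>1, \<dots>, Y\<^sub>m\<close> by \<open>\<phi>\<close> therefore
  gives (i), by Gronwall's inequality applied to \<open>\<rho>\<^sub>j\<close> along an integral curve. As
  \<open>[\<phi> X, \<phi> Y]\<close> equals \<open>\<phi>\<^sup>2 [X, Y]\<close> modulo \<open>X\<close> and \<open>Y\<close>, condition (ii) need only be checked for
  the \<open>Y\<^sub>l\<close>. Take \<open>Y\<^sub>1 = \<partial>\<^sub>1\<close> and \<open>Y\<^sub>l = cos x\<^sub>1 \<partial>\<^sub>l + sin x\<^sub>1 \<partial>\<^bsub>l+m-1\<^esub>\<close> for \<open>2 \<le> l \<le> m\<close>, with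
  \<open>\<partial>\<^sub>j\<close> read as \<open>0\<close> for \<open>j > n\<close>: then \<open>Y\<^sub>l\<close> and \<open>[Y\<^sub>1, Y\<^sub>l]\<close> span \<open>\<partial>\<^sub>l\<close> and \<open>\<partial>\<^bsub>l+m-1\<^esub>\<close>, which
  covers all directions as soon as \<open>2 m \<ge> n + 1\<close>.
\<close>

section \<open>Smoothness of trigonometric polynomials\<close>

text \<open>\<open>C_k\<close> recurses through directional derivatives, so a class of
  differentiable functions closed under them consists of smooth functions; continuity at level 0
  follows from differentiability.\<close>

lemma smooth_coinduct:
  assumes "P f"
    and step: "\<And>f. P f \<Longrightarrow> (\<forall>x. f differentiable (at x)) \<and>
                  (\<forall>v. P (\<lambda>x. frechet_derivative f (at x) v))"
  shows "smooth f"
proof -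
  have "P g \<Longrightarrow> C_k k g" for k g
  proof (induction k arbitrary: g)
    case 0
    then have "g differentiable (at x)" for x
      using step by blast
    then show ?case
      by (auto intro!: continuous_at_imp_continuous_on differentiable_imp_continuous_within)
  next
    case (Suc k)
    then show ?case
      using step by auto
  qed
  then show ?thesis
    using \<open>P f\<close> by (auto simp: smooth_def)
qed

text \<open>Only \<open>sin\<close> needs a constructor, since cosines arise by a phase shift. The
  values are vectors, so that scalar factors can multiply whole vector fields. The frequencies
  \<open>b\<close> are arbitrary, so periodicity is proved separately.\<close>

inductive trig_poly :: "('a::real_inner \<Rightarrow> 'b::real_normed_vector) \<Rightarrow> bool" where
  const: "trig_poly (\<lambda>x. w)"
| add: "trig_poly F \<Longrightarrow> trig_poly G \<Longrightarrow> trig_poly (\<lambda>x. F x + G x)"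
| sin: "trig_poly F \<Longrightarrow> trig_poly (\<lambda>x. sin (a + b \<bullet> x) *\<^sub>R F x)"

lemma trig_poly_scaleR: "trig_poly F \<Longrightarrow> trig_poly (\<lambda>x. c *\<^sub>R F x)"
proof (induction rule: trig_poly.induct)
  case (const w)
  show ?case by (rule trig_poly.const)
next
  case (add F G)
  then show ?case
    by (simp add: scaleR_add_right trig_poly.add)
next
  case (sin F a b)
  then show ?case
    using trig_poly.sin[OF sin.IH, of a b] by (simp add: mult.commute)
qed

lemma trig_poly_cos:
  assumes "trig_poly F"
  shows "trig_poly (\<lambda>x. cos (a + b \<bullet> x) *\<^sub>R F x)"
proof -
  have "cos (a + b \<bullet> x) = sin ((a + pi / 2) + b \<bullet> x)" for x
    by (simp add: sin_add cos_add algebra_simps)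
  then show ?thesis
    using trig_poly.sin[OF assms, of "a + pi / 2" b] by simp
qed

lemma trig_poly_derivative:
  "trig_poly F \<Longrightarrow>
    \<exists>F'. (\<forall>x. (F has_derivative F' x) (at x)) \<and> (\<forall>v. trig_poly (\<lambda>x. F' x v))"
proof (induction rule: trig_poly.induct)
  case (const w)
  show ?case
    by (rule exI[of _ "\<lambda>x v. 0"]) (simp add: trig_poly.const)
next
  case (add F G)
  then obtain F' G' where
    "\<And>x. (F has_derivative F' x) (at x)" "\<And>v. trig_poly (\<lambda>x. F' x v)"
    "\<And>x. (G has_derivative G' x) (at x)" "\<And>v. trig_poly (\<lambda>x. G' x v)"
    by blast
  then show ?case
    by (intro exI[of _ "\<lambda>x v. F' x v + G' x v"]) (auto intro: has_derivative_add trig_poly.add)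
next
  case (sin F a b)
  then obtain F' where
    F': "\<And>x. (F has_derivative F' x) (at x)" "\<And>v. trig_poly (\<lambda>x. F' x v)"
    by blast
  have "((\<lambda>x. sin (a + b \<bullet> x) *\<^sub>R F x) has_derivative
      (\<lambda>v. sin (a + b \<bullet> x) *\<^sub>R F' x v + cos (a + b \<bullet> x) *\<^sub>R (b \<bullet> v) *\<^sub>R F x)) (at x)" for x
    by (auto intro!: derivative_eq_intros F'(1) simp: fun_eq_iff mult.commute)
  \<comment> \<open>For fixed \<open>v\<close> the factor \<open>b \<bullet> v\<close> is a
    constant, so the product rule stays in the class.\<close>
  moreover have "trig_poly (\<lambda>x. sin (a + b \<bullet> x) *\<^sub>R F' x v + cos (a + b \<bullet> x) *\<^sub>R (b \<bullet> v) *\<^sub>R F x)" for v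
    by (intro trig_poly.add trig_poly.sin trig_poly_cos trig_poly_scaleR F'(2) sin.hyps)
  ultimately show ?case
    by (intro exI[of _ "\<lambda>x v. sin (a + b \<bullet> x) *\<^sub>R F' x v + cos (a + b \<bullet> x) *\<^sub>R (b \<bullet> v) *\<^sub>R F x"]) blast
qed

lemma smooth_trig_poly: "trig_poly F \<Longrightarrow> smooth F"
proof (rule smooth_coinduct[where P = trig_poly])
  fix F :: "'a \<Rightarrow> 'b"
  assume "trig_poly F"
  then obtain F' where
    F': "\<And>x. (F has_derivative F' x) (at x)" "\<And>v. trig_poly (\<lambda>x. F' x v)"
    using trig_poly_derivative by blast
  have "frechet_derivative F (at x) = F' x" for x
    using frechet_derivative_at[OF F'(1)] by simp
  then show "(\<forall>x. F differentiable (at x)) \<and>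
      (\<forall>v. trig_poly (\<lambda>x. frechet_derivative F (at x) v))"
    using F' by (auto simp: differentiable_def)
qed

section \<open>Invariance of level sets\<close>

text \<open>The bound makes \<open>(g t)\<^sup>2 * exp (- (2 * C * t))\<close> nonincreasing, so a
  zero persists, and \<open>(g t)\<^sup>2 * exp (2 * C * t)\<close> nondecreasing, so a positive
  start never reaches zero. Squaring avoids differentiating the absolute value.\<close>

lemma gronwall_sign:
  fixes g g' :: "real \<Rightarrow> real"
  assumes "0 \<le> T"
    and deriv: "\<And>t. t \<in> {0..T} \<Longrightarrow> (g has_real_derivative g' t) (at t within {0..T})"
    and bound: "\<And>t. t \<in> {0..T} \<Longrightarrow> \<bar>g' t\<bar> \<le> C * \<bar>g t\<bar>"
  shows "g 0 = 0 \<Longrightarrow> g T = 0" and "0 < g 0 \<Longrightarrow> 0 < g T"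
proof -
  have cont: "continuous_on {0..T} g"
    using deriv by (meson DERIV_continuous continuous_on_eq_continuous_within)
  have at: "(g has_real_derivative g' t) (at t)" if "0 < t" "t < T" for t
    using deriv[of t] that by (simp add: at_within_Icc_at)
  have gg': "\<bar>g t * g' t\<bar> \<le> C * (g t)\<^sup>2" if "t \<in> {0..T}" for t
    using mult_left_mono[OF bound[OF that], of "\<bar>g t\<bar>"]
    by (simp add: abs_mult power2_eq_square mult.left_commute)
  have upper: "(g s)\<^sup>2 * exp (- (2 * C * s)) \<le> (g 0)\<^sup>2" if "s \<in> {0..T}" for s
  proof -
    have "- ((g 0)\<^sup>2 * exp (- (2 * C * 0))) \<le> - ((g s)\<^sup>2 * exp (- (2 * C * s)))"
    proof (rule DERIV_nonneg_imp_increasing_open[where f = "\<lambda>t. - ((g t)\<^sup>2 * exp (- (2 * C * t)))"])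
      fix t assume t: "0 < t" "t < s"
      have "((\<lambda>t. - ((g t)\<^sup>2 * exp (- (2 * C * t)))) has_real_derivative
          2 * (C * (g t)\<^sup>2 - g t * g' t) * exp (- (2 * C * t))) (at t)"
        using t that by (auto intro!: derivative_eq_intros at simp: algebra_simps power2_eq_square)
      moreover have "0 \<le> 2 * (C * (g t)\<^sup>2 - g t * g' t) * exp (- (2 * C * t))"
        using gg'[of t] t that by simp
      ultimately show "\<exists>y. ((\<lambda>t. - ((g t)\<^sup>2 * exp (- (2 * C * t)))) has_real_derivative y) (at t) \<and> 0 \<le> y"
        by blast
    qed (use that in \<open>auto intro!: continuous_intros continuous_on_subset[OF cont]\<close>)
    then show ?thesis by simp
  qed
  have lower: "(g 0)\<^sup>2 \<le> (g s)\<^sup>2 * exp (2 * C * s)" if "s \<in> {0..T}" for s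
  proof -
    have "(g 0)\<^sup>2 * exp (2 * C * 0) \<le> (g s)\<^sup>2 * exp (2 * C * s)"
    proof (rule DERIV_nonneg_imp_increasing_open[where f = "\<lambda>t. (g t)\<^sup>2 * exp (2 * C * t)"])
      fix t assume t: "0 < t" "t < s"
      have "((\<lambda>t. (g t)\<^sup>2 * exp (2 * C * t)) has_real_derivative
          2 * (C * (g t)\<^sup>2 + g t * g' t) * exp (2 * C * t)) (at t)"
        using t that by (auto intro!: derivative_eq_intros at simp: algebra_simps power2_eq_square)
      moreover have "0 \<le> 2 * (C * (g t)\<^sup>2 + g t * g' t) * exp (2 * C * t)"
        using gg'[of t] t that by simp
      ultimately show "\<exists>y. ((\<lambda>t. (g t)\<^sup>2 * exp (2 * C * t)) has_real_derivative y) (at t) \<and> 0 \<le> y"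
        by blast
    qed (use that in \<open>auto intro!: continuous_intros continuous_on_subset[OF cont]\<close>)
    then show ?thesis by simp
  qed
  show "g T = 0" if "g 0 = 0"
    using upper[of T] that \<open>0 \<le> T\<close> by (simp add: mult_le_0_iff)
  show "0 < g T" if pos: "0 < g 0"
  proof (rule ccontr)
    assume "\<not> 0 < g T"
    \<comment> \<open>A loss of positivity would force a zero in between, where \<open>lower\<close>
      gives \<open>(g 0)\<^sup>2 \<le> 0\<close>.\<close>
    then obtain s where "0 \<le> s" "s \<le> T" "g s = 0"
      using IVT2'[of g T 0 0] pos \<open>0 \<le> T\<close> cont by (meson less_imp_le not_less)
    then show False
      using lower[of s] pos by simp
  qed
qed

text \<open>Along an integral curve, \<open>r\<close> has derivative \<open>d \<bullet> X\<close>,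
  so \<open>gronwall_sign\<close> applies on each \<open>{0..T}\<close>. The bound is symmetric in
  the sign of \<open>X\<close> and thus also serves the reversed field.\<close>

lemma flow_invariant_affine:
  fixes d :: "real ^ 'n::finite"
  assumes r: "\<And>x. r x = c + d \<bullet> x"
    and bound: "\<And>x. \<bar>d \<bullet> X x\<bar> \<le> C * \<bar>r x\<bar>"
  shows "flow_invariant X {x. r x = 0}" and "flow_invariant X {x. 0 < r x}"
proof -
  have *: "(r (\<gamma> 0) = 0 \<longrightarrow> r (\<gamma> T) = 0) \<and> (0 < r (\<gamma> 0) \<longrightarrow> 0 < r (\<gamma> T))"
    if "integral_curve X I \<gamma>" "0 \<in> I" "T \<in> I" "0 \<le> T" for I \<gamma> T
  proof -
    have sub: "{0..T} \<subseteq> I"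
      using that unfolding integral_curve_def is_interval_1 by (meson atLeastAtMost_iff subsetI)
    have "((\<lambda>t. r (\<gamma> t)) has_real_derivative d \<bullet> X (\<gamma> t)) (at t within {0..T})"
      if t: "t \<in> {0..T}" for t
    proof -
      have "(\<gamma> has_vector_derivative X (\<gamma> t)) (at t within {0..T})"
        using \<open>integral_curve X I \<gamma>\<close> sub t
        unfolding integral_curve_def by (meson has_vector_derivative_within_subset subsetD)
      then show ?thesis
        unfolding r has_vector_derivative_def has_field_derivative_def
        by (auto intro!: derivative_eq_intros simp: fun_eq_iff mult.commute)
    qed
    from gronwall_sign[OF \<open>0 \<le> T\<close> this bound] show ?thesis
      by blast
  qed
  show "flow_invariant X {x. r x = 0}" "flow_invariant X {x. 0 < r x}"
    unfolding flow_invariant_def using * by blast+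
qed

lemma flow_invariant_INT:
  assumes "\<And>j. j \<in> J \<Longrightarrow> flow_invariant X (N j)"
  shows "flow_invariant X (\<Inter>j\<in>J. N j)"
  using assms unfolding flow_invariant_def by blast

section \<open>The cutoff function\<close>

text \<open>The constant gradient of \<open>rho e n \<epsilon> j\<close>, with the successor of
  \<open>n\<close> wrapping round to 1.\<close>

definition rho_normal :: "(nat \<Rightarrow> 'n::finite) \<Rightarrow> nat \<Rightarrow> nat \<Rightarrow> real ^ 'n" where
  "rho_normal e n j = axis (e (if j = n then 1 else j + 1)) 1 - axis (e j) 1"

definition cutoff :: "(nat \<Rightarrow> 'n::finite) \<Rightarrow> nat \<Rightarrow> real \<Rightarrow> real ^ 'n \<Rightarrow> real" where
  "cutoff e n \<epsilon> x = (\<Prod>j\<in>{1..n}. 1 - cos (rho e n \<epsilon> j x))"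

lemma rho_affine:
  "rho e n \<epsilon> j x = ((if j = n then 2 * pi else 0) - \<epsilon>) + rho_normal e n j \<bullet> x"
  by (simp add: rho_def rho_normal_def inner_diff_left inner_axis')

lemma trig_poly_cutoff:
  assumes "trig_poly F"
  shows "trig_poly (\<lambda>x. cutoff e n \<epsilon> x *\<^sub>R F x)"
proof -
  have "trig_poly (\<lambda>x. (\<Prod>j\<in>J. 1 - cos (rho e n \<epsilon> j x)) *\<^sub>R F x)" if "finite J" for J
    using that
  proof (induction J rule: finite_induct)
    case empty
    then show ?case using assms by simp
  next
    case (insert j J)
    let ?G = "\<lambda>x. (\<Prod>j\<in>J. 1 - cos (rho e n \<epsilon> j x)) *\<^sub>R F x"
    \<comment> \<open>The new factor \<open>1 - cos\<close> is expanded into a sum to fit the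
      closure rules.\<close>
    have "trig_poly (\<lambda>x. ?G x + cos (rho e n \<epsilon> j x) *\<^sub>R (- 1) *\<^sub>R ?G x)"
      unfolding rho_affine[of e n \<epsilon> j]
      using insert.IH by (intro trig_poly.add trig_poly_cos trig_poly_scaleR)
    then show ?case
      using insert.hyps by (simp add: algebra_simps)
  qed
  then show ?thesis
    by (simp add: cutoff_def)
qed

text \<open>Shifting one coordinate by \<open>2 * pi\<close> changes each \<open>rho\<close> by
  \<open>2 * pi\<close> times an entry of its gradient, and these entries are integers.\<close>

lemma cutoff_periodic: "cutoff e n \<epsilon> (x + (2 * pi) *\<^sub>R axis i 1) = cutoff e n \<epsilon> x"
proof -
  have "cos (rho e n \<epsilon> j (x + (2 * pi) *\<^sub>R axis i 1)) = cos (rho e n \<epsilon> j x)" for j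
  proof -
    have "rho_normal e n j $ i \<in> {- 1, 0, 1}"
      by (auto simp: rho_normal_def axis_def)
    then obtain k :: int where k: "rho_normal e n j $ i = of_int k"
      by (metis insert_iff empty_iff of_int_0 of_int_1 of_int_minus)
    have "rho e n \<epsilon> j (x + (2 * pi) *\<^sub>R axis i 1) = rho e n \<epsilon> j x + 2 * pi * of_int k"
      by (simp add: rho_affine inner_add_right inner_axis k)
    then show ?thesis
      by (metis cos_add cos_int_2pin diff_zero mult.right_neutral mult_zero_right sin_int_2pin)
  qed
  then show ?thesis
    by (simp add: cutoff_def)
qed

text \<open>One factor vanishes at least linearly, as \<open>1 - cos y\<close> equals twice the
  square of \<open>sin (y / 2)\<close>; each other factor is at most 2.\<close>

lemma cutoff_bound:
  assumes "j \<in> {1..n}"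
  shows "\<bar>cutoff e n \<epsilon> x\<bar> \<le> 2 ^ n * \<bar>rho e n \<epsilon> j x\<bar>"
proof -
  let ?u = "\<lambda>j. rho e n \<epsilon> j x"
  have "1 - cos y \<le> \<bar>y\<bar>" for y :: real
  proof -
    have "1 - cos y = 2 * (\<bar>sin (y / 2)\<bar> * \<bar>sin (y / 2)\<bar>)"
      using cos_double_sin[of "y / 2"] by (simp add: power2_eq_square flip: abs_mult)
    also have "\<dots> \<le> 2 * (\<bar>y / 2\<bar> * 1)"
      by (intro mult_left_mono mult_mono abs_sin_x_le_abs_x) auto
    finally show ?thesis by simp
  qed
  then have 1: "\<bar>1 - cos (?u j)\<bar> \<le> \<bar>?u j\<bar>"
    by simp
  have "(\<Prod>i\<in>{1..n} - {j}. \<bar>1 - cos (?u i)\<bar>) \<le> (\<Prod>i\<in>{1..n} - {j}. 2)"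
  proof (rule prod_mono)
    fix i
    have "- 1 \<le> cos (?u i)" by simp
    then show "0 \<le> \<bar>1 - cos (?u i)\<bar> \<and> \<bar>1 - cos (?u i)\<bar> \<le> 2"
      by simp
  qed
  also have "\<dots> \<le> 2 ^ n"
    using assms by (simp add: card_Diff_singleton power_increasing)
  finally have 2: "(\<Prod>i\<in>{1..n} - {j}. \<bar>1 - cos (?u i)\<bar>) \<le> 2 ^ n" .
  have "\<bar>cutoff e n \<epsilon> x\<bar> = \<bar>1 - cos (?u j)\<bar> * (\<Prod>i\<in>{1..n} - {j}. \<bar>1 - cos (?u i)\<bar>)"
    unfolding cutoff_def abs_prod using assms by (intro prod.remove) auto
  also have "\<dots> \<le> \<bar>?u j\<bar> * 2 ^ n"
    using 1 2 by (intro mult_mono) (auto intro: prod_nonneg)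
  finally show ?thesis by (simp add: mult.commute)
qed

lemma sum_rho:
  assumes "1 \<le> n"
  shows "(\<Sum>j\<in>{1..n}. rho e n \<epsilon> j x) = 2 * pi - real n * \<epsilon>"
proof -
  \<comment> \<open>The wrap-around term is split off; the remaining differences telescope.\<close>
  have "{1..n} = insert n {1..<n}"
    using assms by auto
  then have "(\<Sum>j\<in>{1..n}. rho e n \<epsilon> j x) =
      rho e n \<epsilon> n x + (\<Sum>j\<in>{1..<n}. x $ e (Suc j) - x $ e j - \<epsilon>)"
    by (simp add: rho_def)
  also have "(\<Sum>j\<in>{1..<n}. x $ e (Suc j) - x $ e j - \<epsilon>) = x $ e n - x $ e 1 - (real n - 1) * \<epsilon>"
    using sum_Suc_diff'[OF assms, of "\<lambda>j. x $ e j"] assms by (simp add: sum_subtractf of_nat_diff)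
  finally show ?thesis
    by (simp add: rho_def algebra_simps)
qed

lemma cutoff_pos:
  assumes "0 < \<epsilon>" "x \<in> R_eps e n \<epsilon>"
  shows "0 < cutoff e n \<epsilon> x"
  unfolding cutoff_def
proof (rule prod_pos)
  fix j assume j: "j \<in> {1..n}"
  have pos: "0 < rho e n \<epsilon> i x" if "i \<in> {1..n}" for i
    using assms that by (simp add: R_eps_def)
  have "rho e n \<epsilon> j x \<le> (\<Sum>i\<in>{1..n}. rho e n \<epsilon> i x)"
    using j pos by (intro member_le_sum) (auto intro: less_imp_le)
  \<comment> \<open>Strict because \<open>j\<close> witnesses \<open>1 \<le> n\<close>, so
    \<open>real n * \<epsilon>\<close> is positive.\<close>
  also have "\<dots> < 2 * pi"
    using j \<open>0 < \<epsilon>\<close> sum_rho[of n e \<epsilon> x] by simp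
  finally have less: "rho e n \<epsilon> j x < 2 * pi" .
  have "cos (rho e n \<epsilon> j x) \<noteq> 1"
  proof
    assume "cos (rho e n \<epsilon> j x) = 1"
    then obtain k :: int where "rho e n \<epsilon> j x = real_of_int k * 2 * pi"
      using cos_one_2pi_int by blast
    then have "0 < real_of_int k" "real_of_int k < 1"
      using pos[OF j] less by (simp_all add: zero_less_mult_iff)
    then show False by simp
  qed
  then show "0 < 1 - cos (rho e n \<epsilon> j x)"
    using cos_le_one[of "rho e n \<epsilon> j x"] by linarith
qed

section \<open>The vector fields\<close>

text \<open>Indices in \<open>frame\<close> reach \<open>2 * m - 1\<close>, which may exceed
  \<open>n\<close>; the value 0 there lets one formula serve all cases.\<close>

definition coord_dir :: "(nat \<Rightarrow> 'n::finite) \<Rightarrow> nat \<Rightarrow> nat \<Rightarrow> real ^ 'n" where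
  "coord_dir e n j = (if j \<le> n then axis (e j) 1 else 0)"

text \<open>For \<open>l\<close> other than 1 the field rotates with angle \<open>x $ e 1\<close>,
  so its derivative in that coordinate is the same combination turned by a right angle.\<close>

definition frame :: "(nat \<Rightarrow> 'n::finite) \<Rightarrow> nat \<Rightarrow> nat \<Rightarrow> nat \<Rightarrow> 'n vfield" where
  "frame e n m l x =
     (if l = 1 then coord_dir e n 1
      else cos (x $ e 1) *\<^sub>R coord_dir e n l + sin (x $ e 1) *\<^sub>R coord_dir e n (l + m - 1))"

lemma trig_poly_frame:
  fixes e :: "nat \<Rightarrow> 'n::finite"
  shows "trig_poly (frame e n m l)"
proof -
  have "trig_poly (\<lambda>x :: real ^ 'n. cos (0 + axis (e 1) 1 \<bullet> x) *\<^sub>R coord_dir e n l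
      + sin (0 + axis (e 1) 1 \<bullet> x) *\<^sub>R coord_dir e n (l + m - 1))"
    by (intro trig_poly.add trig_poly.sin trig_poly_cos trig_poly.const)
  then show ?thesis
    by (cases "l = 1") (simp_all add: frame_def[abs_def] inner_axis' trig_poly.const)
qed

lemma frame_periodic: "frame e n m l (x + (2 * pi) *\<^sub>R axis i 1) = frame e n m l x"
  by (auto simp: frame_def axis_def)

lemma norm_frame_le: "norm (frame e n m l x) \<le> 2"
proof -
  have d: "norm (coord_dir e n j) \<le> 1" for j
    by (simp add: coord_dir_def)
  have "norm (cos a *\<^sub>R coord_dir e n j + sin a *\<^sub>R coord_dir e n k) \<le> 1 * 1 + 1 * 1" for a :: real and j k
    by (intro norm_triangle_mono) (auto intro!: mult_le_one d)
  then show ?thesis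
    using d[of 1] by (auto simp: frame_def)
qed

lemma frame_has_derivative:
  assumes "l \<noteq> 1"
  shows "(frame e n m l has_derivative
    (\<lambda>v. v $ e 1 *\<^sub>R (cos (x $ e 1) *\<^sub>R coord_dir e n (l + m - 1) - sin (x $ e 1) *\<^sub>R coord_dir e n l)))
    (at x)"
proof -
  have eq: "frame e n m l = (\<lambda>x. cos (x $ e 1) *\<^sub>R coord_dir e n l + sin (x $ e 1) *\<^sub>R coord_dir e n (l + m - 1))"
    using assms by (simp add: frame_def fun_eq_iff)
  have "((\<lambda>x. x $ e 1) has_derivative (\<lambda>v. v $ e 1)) (at x)"
    by (rule bounded_linear.has_derivative[OF bounded_linear_vec_nth has_derivative_ident])
  then show ?thesis
    unfolding eq
    by (auto intro!: derivative_eq_intros simp: fun_eq_iff algebra_simps)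
qed

section \<open>Brackets and the spanning condition\<close>

text \<open>Product rule: modulo \<open>w\<close> and \<open>Y x\<close>, only the bracket
  \<open>Y' w\<close> of the unscaled fields survives. A constant \<open>w\<close> suffices because
  spanning uses only brackets with the first field.\<close>

lemma lie_bracket_scaleR_const:
  fixes w :: "real ^ 'n::finite"
  assumes p: "(p has_derivative p') (at x)" and Y: "(Y has_derivative Y') (at x)"
  shows "lie_bracket (\<lambda>x. p x *\<^sub>R w) (\<lambda>x. p x *\<^sub>R Y x) x =
    (p x)\<^sup>2 *\<^sub>R Y' w + (p x * p' w) *\<^sub>R Y x - (p x * p' (Y x)) *\<^sub>R w"
proof -
  have lin: "p' (c *\<^sub>R v) = c * p' v" "Y' (c *\<^sub>R v) = c *\<^sub>R Y' v" for c v
    using has_derivative_linear[OF p] has_derivative_linear[OF Y] by (simp_all add: linear_cmul)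
  have "((\<lambda>x. p x *\<^sub>R w) has_derivative (\<lambda>v. p' v *\<^sub>R w)) (at x)"
    by (auto intro!: derivative_eq_intros p)
  moreover have "((\<lambda>x. p x *\<^sub>R Y x) has_derivative (\<lambda>v. p x *\<^sub>R Y' v + p' v *\<^sub>R Y x)) (at x)"
    by (auto intro!: derivative_eq_intros p Y)
  ultimately show ?thesis
    by (simp add: lie_bracket_def lin power2_eq_square flip: frechet_derivative_at)
qed

lemma span_frame_cutoff:
  fixes e :: "nat \<Rightarrow> 'n::finite"
  assumes bij: "bij_betw e {1..n} (UNIV :: 'n set)"
    and "0 < \<epsilon>" and m: "m \<le> n" "n + 1 \<le> 2 * m" and x: "x \<in> R_eps e n \<epsilon>"
  defines "f \<equiv> \<lambda>l x. cutoff e n \<epsilon> x *\<^sub>R frame e n m l x"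
  shows "span ({f l x | l. l \<in> {1..m}} \<union>
    {lie_bracket (f l) (f k) x | l k. l \<in> {1..m} \<and> k \<in> {1..m}}) = UNIV"
    (is "span ?S = UNIV")
proof -
  let ?p = "cutoff e n \<epsilon>" and ?D = "coord_dir e n" and ?a = "x $ e 1"
  have p: "?p x \<noteq> 0"
    using cutoff_pos[OF \<open>0 < \<epsilon>\<close> x] by simp
  have "trig_poly ?p"
    using trig_poly_cutoff[OF trig_poly.const[of "1::real"]] by simp
  then obtain p' where p': "(?p has_derivative p') (at x)"
    using trig_poly_derivative by blast
  have frame: "frame e n m l x \<in> span ?S" if "l \<in> {1..m}" for l
  proof -
    have "f l x \<in> span ?S"
      using that by (auto intro: span_base)
    from span_scale[OF this, of "inverse (?p x)"] show ?thesis
      using p by (simp add: f_def)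
  qed
  have D1: "?D 1 \<in> span ?S"
    using frame[of 1] m by (simp add: frame_def)
  have pair: "?D l \<in> span ?S \<and> ?D (l + m - 1) \<in> span ?S" if l: "l \<in> {2..m}" for l
  proof -
    \<comment> \<open>\<open>U\<close> is the field itself and \<open>V\<close> its derivative along
      \<open>?D 1\<close>; inverting the rotation recovers both coordinate directions.\<close>
    define U where "U = cos ?a *\<^sub>R ?D l + sin ?a *\<^sub>R ?D (l + m - 1)"
    define V where "V = cos ?a *\<^sub>R ?D (l + m - 1) - sin ?a *\<^sub>R ?D l"
    have U: "U \<in> span ?S"
      using frame[of l] l by (simp add: frame_def U_def)
    have "1 \<in> {1..m}" "l \<in> {1..m}"
      using l by auto
    then have B: "lie_bracket (f 1) (f l) x \<in> span ?S"
      by (intro span_base) blast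
    have f1: "f 1 = (\<lambda>x. ?p x *\<^sub>R ?D 1)"
      by (simp add: f_def frame_def)
    have "?D 1 $ e 1 = 1" "frame e n m l x = U"
      using m l by (auto simp: coord_dir_def frame_def U_def)
    then have "lie_bracket (f 1) (f l) x =
        (?p x)\<^sup>2 *\<^sub>R V + (?p x * p' (?D 1)) *\<^sub>R U - (?p x * p' U) *\<^sub>R ?D 1"
      using lie_bracket_scaleR_const[OF p' frame_has_derivative[of l e n m x], of "?D 1"] l
      unfolding f1 by (simp add: f_def V_def)
    \<comment> \<open>Solved for \<open>V\<close>, since \<open>U\<close> and \<open>?D 1\<close>
      already lie in the span and \<open>?p x\<close> is nonzero.\<close>
    then have "(?p x)\<^sup>2 *\<^sub>R V =
        lie_bracket (f 1) (f l) x - (?p x * p' (?D 1)) *\<^sub>R U + (?p x * p' U) *\<^sub>R ?D 1"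
      by simp
    also have "\<dots> \<in> span ?S"
      by (intro span_add span_diff span_scale U D1 B)
    finally have "inverse ((?p x)\<^sup>2) *\<^sub>R (?p x)\<^sup>2 *\<^sub>R V \<in> span ?S"
      by (rule span_scale)
    then have V: "V \<in> span ?S"
      using p by simp
    have "cos ?a *\<^sub>R U - sin ?a *\<^sub>R V = ((sin ?a)\<^sup>2 + (cos ?a)\<^sup>2) *\<^sub>R ?D l"
      unfolding U_def V_def power2_eq_square scaleR_add_left by (simp add: algebra_simps)
    moreover have "sin ?a *\<^sub>R U + cos ?a *\<^sub>R V = ((sin ?a)\<^sup>2 + (cos ?a)\<^sup>2) *\<^sub>R ?D (l + m - 1)"
      unfolding U_def V_def power2_eq_square scaleR_add_left by (simp add: algebra_simps)
    moreover have "cos ?a *\<^sub>R U - sin ?a *\<^sub>R V \<in> span ?S" "sin ?a *\<^sub>R U + cos ?a *\<^sub>R V \<in> span ?S"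
      by (intro span_add span_diff span_scale U V)+
    ultimately show ?thesis
      by simp
  qed
  have "?D j \<in> span ?S" if j: "j \<in> {1..n}" for j
  proof -
    consider "j = 1" | "j \<in> {2..m}" | "m < j"
      using j by force
    then show ?thesis
    proof cases
      case 1
      then show ?thesis using D1 by simp
    next
      case 2
      then show ?thesis using pair by blast
    next
      case 3
      \<comment> \<open>The upper bound is where \<open>n + 1 \<le> 2 * m\<close> enters:
        \<open>j \<le> n \<le> 2 * m - 1\<close>.\<close>
      then have "j - m + 1 \<in> {2..m}" "(j - m + 1) + m - 1 = j"
        using j m by auto
      then show ?thesis using pair[of "j - m + 1"] by simp
    qed
  qed
  then have e: "axis (e j) 1 \<in> span ?S" if "j \<in> {1..n}" for j
    using that by (auto simp: coord_dir_def)
  have "axis i 1 \<in> span ?S" for i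
  proof -
    have "i \<in> e ` {1..n}"
      using bij by (simp add: bij_betw_def)
    then show ?thesis
      using e by blast
  qed
  then have "Basis \<subseteq> span ?S"
    by (auto simp: Basis_vec_def)
  then have "span Basis \<subseteq> span ?S"
    by (rule span_minimal) (rule subspace_span)
  then show ?thesis
    unfolding span_Basis by (rule top.extremum_uniqueI)
qed

section \<open>Verification of both conditions\<close>

lemma good_fields_cutoff_frame:
  fixes e :: "nat \<Rightarrow> 'n::finite"
  assumes bij: "bij_betw e {1..n} (UNIV :: 'n set)"
    and "0 < \<epsilon>" and m: "m \<le> n" "n + 1 \<le> 2 * m"
  shows "good_fields e n \<epsilon> m (\<lambda>l x. cutoff e n \<epsilon> x *\<^sub>R frame e n m l x)"
proof -
  define f where "f = (\<lambda>l x. cutoff e n \<epsilon> x *\<^sub>R frame e n m l x)"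
  \<comment> \<open>The constant collects the Cauchy-Schwarz factor, the bound 2 on the frame and
    the factor \<open>2 ^ n\<close> from \<open>cutoff_bound\<close>.\<close>
  have bound: "\<bar>rho_normal e n j \<bullet> f l x\<bar> \<le> (norm (rho_normal e n j) * 2 * 2 ^ n) * \<bar>rho e n \<epsilon> j x\<bar>"
    if "j \<in> {1..n}" for j l x
  proof -
    have "\<bar>rho_normal e n j \<bullet> f l x\<bar> \<le> norm (rho_normal e n j) * (\<bar>cutoff e n \<epsilon> x\<bar> * norm (frame e n m l x))"
      using Cauchy_Schwarz_ineq2[of "rho_normal e n j" "f l x"] by (simp add: f_def)
    also have "\<dots> \<le> norm (rho_normal e n j) * ((2 ^ n * \<bar>rho e n \<epsilon> j x\<bar>) * 2)"
      using that by (intro mult_left_mono mult_mono cutoff_bound norm_frame_le) auto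
    finally show ?thesis by (simp add: mult_ac)
  qed
  have inv: "flow_invariant (f l) {x. rho e n \<epsilon> j x = 0}" "flow_invariant (f l) {x. 0 < rho e n \<epsilon> j x}"
    "flow_invariant (\<lambda>x. - f l x) {x. rho e n \<epsilon> j x = 0}"
    "flow_invariant (\<lambda>x. - f l x) {x. 0 < rho e n \<epsilon> j x}"
    if "j \<in> {1..n}" for j l
    by (rule flow_invariant_affine[OF rho_affine, where C = "norm (rho_normal e n j) * 2 * 2 ^ n"];
        use bound[OF that] in simp)+
  \<comment> \<open>An intersection of open half-spaces, each already invariant.\<close>
  have R: "R_eps e n \<epsilon> = (\<Inter>j\<in>{1..n}. {x. 0 < rho e n \<epsilon> j x})"
    by (auto simp: R_eps_def)
  have "flow_invariant (f l) (R_eps e n \<epsilon>)" "flow_invariant (\<lambda>x. - f l x) (R_eps e n \<epsilon>)" for l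
    unfolding R by (intro flow_invariant_INT inv; assumption)+
  moreover have "smooth (f l)" "periodic_2pi (f l)" for l
    unfolding f_def
    by (auto intro: smooth_trig_poly trig_poly_cutoff trig_poly_frame
        simp: periodic_2pi_def cutoff_periodic frame_periodic)
  moreover have "span ({f l x | l. l \<in> {1..m}} \<union>
      {lie_bracket (f l) (f k) x | l k. l \<in> {1..m} \<and> k \<in> {1..m}}) = UNIV"
    if "x \<in> R_eps e n \<epsilon>" for x
    unfolding f_def using span_frame_cutoff[OF bij \<open>0 < \<epsilon>\<close> m that] .
  ultimately have "good_fields e n \<epsilon> m f"
    unfolding good_fields_def using inv by blast
  then show ?thesis by (simp add: f_def)
qed

theorem theorem1p5:
  fixes n :: nat and \<epsilon> :: real and e :: "nat \<Rightarrow> 'n::finite"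
  assumes "n \<ge> 2"
    and "bij_betw e {1..n} (UNIV :: 'n set)"
    and "0 < \<epsilon>" and "\<epsilon> < 2 * pi / real n"
  shows "(\<exists>m\<le>n. \<exists>f :: nat \<Rightarrow> 'n vfield. good_fields e n \<epsilon> m f)
    \<and> (\<forall>m\<le>n. odd n \<and> odd m \<and> 2 * m \<ge> n + 1 \<longrightarrow> (\<exists>f :: nat \<Rightarrow> 'n vfield. good_fields e n \<epsilon> m f))
    \<and> (\<forall>m\<le>n. even n \<and> 2 * m \<ge> n + 2 \<longrightarrow> (\<exists>f :: nat \<Rightarrow> 'n vfield. good_fields e n \<epsilon> m f))"
proof -
  have ex: "\<exists>f :: nat \<Rightarrow> 'n vfield. good_fields e n \<epsilon> m f" if "m \<le> n" "n + 1 \<le> 2 * m" for m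
    using good_fields_cutoff_frame[OF assms(2,3) that] by blast
  \<comment> \<open>The choice \<open>m = n\<close> settles the first claim; both cases imply
    \<open>n + 1 \<le> 2 * m\<close> directly.\<close>
  have "n + 1 \<le> 2 * n"
    using \<open>n \<ge> 2\<close> by simp
  then show ?thesis
    using ex by (meson add_left_mono le_refl le_trans one_le_numeral)
qed

end
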